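(* Let $r$ be a positive integer, let $s,t$ be integers with $0\le s,t\le r-1$, and let $h$ be a positive integer with $r<\phi^h$. Then there exists a Hofstadter G pair $(u,v)$ with $u\equiv s\pmod r$, $v\equiv t\pmod r$, and $v\le F_{2h+2}-2$.
   Context: $F_0=0$, $F_1=1$, $F_i=F_{i-1}+F_{i-2}$ are the Fibonacci numbers and $\phi=(1+\sqrt5)/2$. Hofstadter's G function is $G(x)=\lfloor\phi^{-1}(x+1)\rfloor$ for integers $x\ge0$ (equivalently $G(0)=0$, $G(1)=1$, $G(x)=x-G(G(x-1))$). A Hofstadter G pair is a pair $(u,v)$ of positive integers with $u=G(v)$. *)

theory Defs
  imports "HOL-Number_Theory.Number_Theory"
begin

definition golden_ratio :: real where
  "golden_ratio = (1 + sqrt 5) / 2"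

definition hofstadter_G :: "nat \<Rightarrow> nat" where
  "hofstadter_G x = nat \<lfloor>inverse golden_ratio * (real x + 1)\<rfloor>"

definition hofstadter_G_pair :: "nat \<Rightarrow> nat \<Rightarrow> bool" where
  "hofstadter_G_pair u v \<longleftrightarrow> u > 0 \<and> v > 0 \<and> u = hofstadter_G v"

end

theory Submission
  imports Defs
begin

text \<open>
  Write \<phi> for the golden ratio. A pair \<open>(u, v)\<close> of naturals satisfies \<open>u = G v\<close> as soon as
  \<open>-1 < v - \<phi> u < \<phi> - 1\<close>. For \<open>u = s + r a\<close> and \<open>v = t + r b\<close> this asks that \<open>b - \<phi> a\<close> lie in an
  open interval of length \<open>\<phi> / r > \<phi> ^ (1 - h)\<close>. Since \<open>F (j+1) - \<phi> F j = (1 - \<phi>) ^ j\<close>, an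
  induction on \<open>h\<close> shows that every half-open interval of length \<open>\<phi> ^ (1 - h)\<close> contains such a
  number with \<open>0 \<le> a < F (h+1)\<close>, so that \<open>u < r F (h+1)\<close>. The bound on \<open>v\<close> follows by comparing \<open>r\<close>
  with the Lucas number \<open>L h = \<phi> ^ h + (1 - \<phi>) ^ h\<close> and using \<open>L h F (h+2) = F (2h+2) + (-1) ^ h\<close>.
  The class \<open>s = t = 0\<close> might yield \<open>u = v = 0\<close>; there a multiple of a pair of consecutive
  Fibonacci numbers is used instead.
\<close>

lemma golden_ratio_bounds: "1 < golden_ratio" "golden_ratio < 2"
proof -
  have "1 < sqrt (5::real)" "sqrt (5::real) < 3"
    by (simp_all add: real_less_rsqrt real_less_lsqrt)
  then show "1 < golden_ratio" "golden_ratio < 2"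
    by (simp_all add: golden_ratio_def)
qed

lemma golden_ratio_square: "golden_ratio * golden_ratio = golden_ratio + 1"
  by (simp add: golden_ratio_def field_simps)

lemma golden_ratio_square_mult: "golden_ratio * (golden_ratio * x) = golden_ratio * x + x"
  using golden_ratio_square by (metis distrib_right mult.assoc mult_1)

lemma golden_ratio_mult_conjugate: "golden_ratio * (golden_ratio - 1) = 1"
  using golden_ratio_square by (simp add: algebra_simps)

lemma golden_ratio_power_mult_conjugate: "golden_ratio ^ n * (golden_ratio - 1) ^ n = 1"
  by (simp add: golden_ratio_mult_conjugate flip: power_mult_distrib)

text \<open>By \<phi>^2 = \<phi> + 1, each Fibonacci step multiplies the difference by the conjugate
  1 - \<phi>.\<close>

lemma fib_diff_golden_ratio:
  "real (fib (Suc n)) - golden_ratio * real (fib n) = (1 - golden_ratio) ^ n"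
proof (induction n)
  case (Suc n)
  have "real (fib (Suc (Suc n))) - golden_ratio * real (fib (Suc n))
      = (1 - golden_ratio) * (real (fib (Suc n)) - golden_ratio * real (fib n))"
    by (simp add: algebra_simps golden_ratio_square_mult)
  then show ?case
    using Suc by simp
qed simp

text \<open>The left side is the Lucas number, written without a predecessor index. Both sides obey
  the Fibonacci recurrence, as \<phi> and 1 - \<phi> are the roots of x^2 = x + 1.\<close>

lemma lucas_golden_ratio:
  "2 * real (fib (Suc n)) - real (fib n) = golden_ratio ^ n + (1 - golden_ratio) ^ n"
proof (induction n rule: fib.induct)
  case (3 n)
  have p: "golden_ratio ^ Suc (Suc n) = golden_ratio ^ Suc n + golden_ratio ^ n"
    by (simp add: golden_ratio_square_mult)
  have "(1 - golden_ratio) * (1 - golden_ratio) = (1 - golden_ratio) + 1"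
    using golden_ratio_square by (simp add: algebra_simps)
  then have q: "(1 - golden_ratio) ^ Suc (Suc n) = (1 - golden_ratio) ^ Suc n + (1 - golden_ratio) ^ n"
    by (metis (no_types, lifting) distrib_right mult.assoc mult_1 power_Suc)
  show ?case
    using 3 unfolding p q by simp
qed simp_all

text \<open>After the addition formula for F (2n+2), what remains is Cassini's identity, the source
  of the sign.\<close>

lemma fib_mult_lucas:
  "int (fib (n + 2)) * (2 * int (fib (Suc n)) - int (fib n)) = int (fib (2 * n + 2)) + (- 1) ^ n"
proof -
  have "fib (2 * n + 2) = fib (Suc (n + Suc n))"
    by (simp add: mult_2)
  also have "\<dots> = fib (Suc (Suc n)) * fib (Suc n) + fib (Suc n) * fib n"
    by (simp only: fib_add)
  finally have "int (fib (2 * n + 2)) = int (fib (Suc n)) * (2 * int (fib n) + int (fib (Suc n)))"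
    by (simp add: algebra_simps)
  moreover have "int (fib (Suc (Suc n)) * fib n) - int ((fib (Suc n))\<^sup>2) = - ((- 1) ^ n)"
    by (fact fib_Cassini_int)
  ultimately show ?thesis
    by (simp add: algebra_simps power2_eq_square)
qed

text \<open>The assumptions amount to \<phi> u < v + 1 < \<phi> (u + 1); division by \<phi> makes
  \<open>u\<close> the floor.\<close>

lemma hofstadter_G_eqI:
  assumes "- 1 < real v - golden_ratio * real u" "real v - golden_ratio * real u < golden_ratio - 1"
  shows "hofstadter_G v = u"
proof -
  have "\<lfloor>inverse golden_ratio * (real v + 1)\<rfloor> = int u"
    using assms golden_ratio_bounds by (simp add: floor_eq_iff field_simps)
  then show ?thesis
    by (simp add: hofstadter_G_def)
qed

text \<open>
  In the step, the interval of length \<open>(\<phi> - 1) ^ n\<close> given to the induction hypothesis extends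
  \<open>[y, y + (\<phi> - 1) ^ (n+1))\<close> to the side from which adding \<open>(1 - \<phi>) ^ (n+1)\<close> moves back into it.
\<close>
lemma golden_ratio_multiples_gap:
  "\<exists>(a::nat) (b::int). a < fib (n + 2) \<and>
     y \<le> b - golden_ratio * a \<and> b - golden_ratio * a < y + (golden_ratio - 1) ^ n"
proof (induction n arbitrary: y)
  case 0
  show ?case
    by (rule exI[of _ 0], rule exI[of _ "\<lceil>y\<rceil>"]) (simp, linarith)
next
  case (Suc n)
  define d where "d = (golden_ratio - 1) ^ Suc n"
  define e where "e = (golden_ratio - 1) ^ Suc (Suc n)"
  have pos: "0 < d" "0 < e"
    using golden_ratio_bounds by (simp_all add: d_def e_def)
  have "(golden_ratio - 1) * golden_ratio = 1"
    using golden_ratio_mult_conjugate by (simp add: mult.commute)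
  then have "(golden_ratio - 1) + (golden_ratio - 1) * (golden_ratio - 1) = 1"
    by (simp add: algebra_simps)
  then have de: "(golden_ratio - 1) ^ n = d + e"
    unfolding d_def e_def
    by (metis (no_types, lifting) distrib_right mult.assoc mult_1 power_Suc)
  have le: "fib (n + 2) \<le> fib (Suc n + 2)"
    by (rule fib_mono) simp
  define z where "z = (if odd (Suc n) then y else y - e)"
  obtain a b where a: "a < fib (n + 2)"
    and b: "z \<le> of_int b - golden_ratio * real a" "of_int b - golden_ratio * real a < z + (d + e)"
    using Suc[of z] unfolding de by blast
  show ?case
  proof (cases "y \<le> of_int b - golden_ratio * real a \<and> of_int b - golden_ratio * real a < y + d")
    case True
    then show ?thesis
      using a le unfolding d_def by (meson less_le_trans)
  next
    case False
    have shift: "of_int (b + int (fib (n + 2))) - golden_ratio * real (a + fib (Suc n))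
        = (of_int b - golden_ratio * real a) + (1 - golden_ratio) ^ Suc n"
      using fib_diff_golden_ratio[of "Suc n"] by (simp add: algebra_simps)
    have sgn: "(1 - golden_ratio) ^ Suc n = (if odd (Suc n) then - d else d)"
      unfolding d_def using power_minus_odd power_minus_even
      by (metis minus_diff_eq)
    \<comment> \<open>The value lies in the added piece of length \<open>e\<close>; since
      \<open>e\<close> \<le> \<open>d\<close>, a move by \<open>d\<close> does not overshoot the
      target.\<close>
    have "e \<le> d"
      using golden_ratio_bounds pos by (simp add: d_def e_def mult_left_le_one_le)
    then have "y \<le> of_int (b + int (fib (n + 2))) - golden_ratio * real (a + fib (Suc n))
        \<and> of_int (b + int (fib (n + 2))) - golden_ratio * real (a + fib (Suc n)) < y + d"
      unfolding shift sgn using b False by (auto simp: z_def split: if_splits)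
    moreover have "a + fib (Suc n) < fib (Suc n + 2)"
      using a by simp
    ultimately show ?thesis
      unfolding d_def by blast
  qed
qed

text \<open>The Lucas number \<open>L\<close> exceeds \<phi>^h by less than 1 for even
  \<open>h\<close> and falls short by less than 1 for odd \<open>h\<close>. Integrality gives r
  \<le> L - 1 or r \<le> L; then multiply by F (h+2).\<close>

lemma mult_fib_le_of_less_golden_ratio_power:
  assumes "h > 0" "real r < golden_ratio ^ h"
  shows "int (r * fib (h + 2)) \<le> int (fib (2 * h + 2)) - (if even h then 2 else 1)"
proof -
  define L where "L = 2 * int (fib (Suc h)) - int (fib h)"
  have L: "of_int L = golden_ratio ^ h + (1 - golden_ratio) ^ h"
    using lucas_golden_ratio[of h] by (simp add: L_def)
  have id: "int (fib (h + 2)) * L = int (fib (2 * h + 2)) + (- 1) ^ h"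
    unfolding L_def by (rule fib_mult_lucas)
  have small: "0 < (golden_ratio - 1) ^ h" "(golden_ratio - 1) ^ h < 1"
    using golden_ratio_bounds \<open>h > 0\<close> by (simp_all add: power_Suc_less_one power_less_one_iff)
  show ?thesis
  proof (cases "even h")
    case True
    have "(1 - golden_ratio) ^ h = (golden_ratio - 1) ^ h"
      using True power_minus_even by (metis minus_diff_eq)
    then have "int r \<le> L - 1"
      using L small assms by linarith
    then have "int (fib (h + 2)) * int r \<le> int (fib (h + 2)) * (L - 1)"
      by (intro mult_left_mono) auto
    \<comment> \<open>Here h \<ge> 2, so subtracting F (h+2) \<ge> 3 turns the +1 of
      \<open>id\<close> into -2.\<close>
    moreover have "fib 4 \<le> fib (h + 2)"
      using True \<open>h > 0\<close> by (intro fib_mono) presburger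
    moreover have "fib 4 = 3"
      by (simp add: numeral_eq_Suc)
    ultimately show ?thesis
      using id True by (simp add: algebra_simps)
  next
    case False
    have "(1 - golden_ratio) ^ h = - ((golden_ratio - 1) ^ h)"
      using False power_minus_odd by (metis minus_diff_eq)
    then have "int r \<le> L"
      using L small assms by linarith
    then have "int (fib (h + 2)) * int r \<le> int (fib (h + 2)) * L"
      by (intro mult_left_mono) auto
    then show ?thesis
      using id False by (simp add: algebra_simps)
  qed
qed

text \<open>The index of the smaller Fibonacci number is the odd one of \<open>h\<close> and h + 1:
  then v - \<phi> u is not positive, and r (\<phi> - 1)^h < 1 keeps it above -1.\<close>

lemma hofstadter_G_mult_fib:
  assumes "real r < golden_ratio ^ h"
  shows "odd h \<Longrightarrow> hofstadter_G (r * fib (Suc h)) = r * fib h"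
    and "even h \<Longrightarrow> hofstadter_G (r * fib (h + 2)) = r * fib (Suc h)"
proof -
  have pos: "0 < (golden_ratio - 1) ^ h"
    using golden_ratio_bounds by simp
  have "real r * (golden_ratio - 1) ^ h < golden_ratio ^ h * (golden_ratio - 1) ^ h"
    using assms pos by (rule mult_strict_right_mono)
  then have lt: "real r * (golden_ratio - 1) ^ h < 1"
    by (simp add: golden_ratio_power_mult_conjugate)
  have nonneg: "0 \<le> real r * (golden_ratio - 1) ^ h"
    using pos by simp
  have diff: "real (r * fib (Suc n)) - golden_ratio * real (r * fib n) = real r * (1 - golden_ratio) ^ n"
    for n
    by (simp add: algebra_simps flip: fib_diff_golden_ratio)
  show "hofstadter_G (r * fib (Suc h)) = r * fib h" if "odd h"
  proof -
    have "(1 - golden_ratio) ^ h = - ((golden_ratio - 1) ^ h)"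
      using that power_minus_odd by (metis minus_diff_eq)
    then have "real (r * fib (Suc h)) - golden_ratio * real (r * fib h)
        = - (real r * (golden_ratio - 1) ^ h)"
      unfolding diff by simp
    then show ?thesis
      using lt nonneg golden_ratio_bounds(1) by (intro hofstadter_G_eqI) linarith+
  qed
  show "hofstadter_G (r * fib (h + 2)) = r * fib (Suc h)" if "even h"
  proof -
    have "(1 - golden_ratio) ^ h = (golden_ratio - 1) ^ h"
      using that power_minus_even by (metis minus_diff_eq)
    then have eq: "real r * (1 - golden_ratio) ^ Suc h
        = - ((golden_ratio - 1) * (real r * (golden_ratio - 1) ^ h))"
      by (simp add: algebra_simps)
    have "0 \<le> (golden_ratio - 1) * (real r * (golden_ratio - 1) ^ h)"
      using nonneg golden_ratio_bounds by (intro mult_nonneg_nonneg) auto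
    moreover have "(golden_ratio - 1) * (real r * (golden_ratio - 1) ^ h) < 1 * 1"
      using lt nonneg golden_ratio_bounds by (intro mult_strict_mono) auto
    moreover have "real (r * fib (h + 2)) - golden_ratio * real (r * fib (Suc h))
        = - ((golden_ratio - 1) * (real r * (golden_ratio - 1) ^ h))"
      using diff[of "Suc h"] unfolding eq by simp
    ultimately show ?thesis
      using golden_ratio_bounds(1) by (intro hofstadter_G_eqI) linarith+
  qed
qed

lemma hofstadter_G_pair_both_multiples:
  assumes "r > 0" "h > 0" "real r < golden_ratio ^ h"
  shows "\<exists>u v. hofstadter_G_pair u v \<and> r dvd u \<and> r dvd v \<and> int v \<le> int (fib (2 * h + 2)) - 2"
proof (cases "even h")
  case True
  then have "int (r * fib (h + 2)) \<le> int (fib (2 * h + 2)) - 2"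
    using mult_fib_le_of_less_golden_ratio_power[of h r] assms by simp
  moreover have "hofstadter_G_pair (r * fib (Suc h)) (r * fib (h + 2))"
    using hofstadter_G_mult_fib(2)[of r h] True assms
    by (simp add: hofstadter_G_pair_def fib_neq_0_nat)
  ultimately show ?thesis
    by (meson dvd_triv_left)
next
  case False
  have bound: "int (r * fib (h + 2)) \<le> int (fib (2 * h + 2)) - 1"
    using mult_fib_le_of_less_golden_ratio_power[of h r] assms False by simp
  \<comment> \<open>For odd \<open>h\<close> the bound is short by 1; passing from F (h+2) to F
    (h+1) gains at least that.\<close>
  have "0 < r * fib h"
    using assms by (simp add: fib_neq_0_nat)
  moreover have "r * fib (h + 2) = r * fib (Suc h) + r * fib h"
    by (simp add: algebra_simps)
  ultimately have "int (r * fib (Suc h)) \<le> int (r * fib (h + 2)) - 1"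
    by linarith
  with bound have "int (r * fib (Suc h)) \<le> int (fib (2 * h + 2)) - 2"
    by linarith
  moreover have "hofstadter_G_pair (r * fib h) (r * fib (Suc h))"
    using hofstadter_G_mult_fib(1)[of r h] False assms
    by (simp add: hofstadter_G_pair_def fib_neq_0_nat)
  ultimately show ?thesis
    by (meson dvd_triv_left)
qed

theorem theorem2:
  fixes r h :: nat and s t :: int
  assumes "r > 0"
    and "0 \<le> s" "s \<le> int r - 1"
    and "0 \<le> t" "t \<le> int r - 1"
    and "h > 0"
    and "real r < golden_ratio ^ h"
  shows "\<exists>u v :: nat. hofstadter_G_pair u v \<and> [int u = s] (mod int r) \<and>
           [int v = t] (mod int r) \<and> int v \<le> int (fib (2 * h + 2)) - 2"
proof (cases "s = 0 \<and> t = 0")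
  case True
  then show ?thesis
    using hofstadter_G_pair_both_multiples[of r h] assms by (simp add: cong_0_iff)
next
  case False
  define \<phi> where "\<phi> = golden_ratio"
  have phi: "1 < \<phi>" "\<phi> < 2" "\<phi> * (\<phi> - 1) = 1"
    unfolding \<phi>_def by (fact golden_ratio_bounds golden_ratio_mult_conjugate)+
  obtain n where h: "h = Suc n"
    using \<open>h > 0\<close> gr0_implies_Suc by blast
  define w where "w = (\<phi> - 1) ^ n"
  have "real r * (\<phi> - 1) ^ h < \<phi> ^ h * (\<phi> - 1) ^ h"
    using assms phi by (intro mult_strict_right_mono) (auto simp: \<phi>_def)
  then have rh: "real r * (\<phi> - 1) ^ h < 1"
    by (simp add: \<phi>_def golden_ratio_power_mult_conjugate)
  then have "\<phi> * (real r * (w * (\<phi> - 1))) < \<phi> * 1"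
    using phi by (intro mult_strict_left_mono) (auto simp: w_def h mult.commute)
  moreover have "\<phi> * (real r * (w * (\<phi> - 1))) = real r * w * (\<phi> * (\<phi> - 1))"
    by (simp add: mult_ac)
  ultimately have rw: "real r * w < \<phi>"
    using phi by simp
  \<comment> \<open>With this \<open>c\<close>, v - \<phi> u = r (b - \<phi> a) - c.\<close>
  define c where "c = \<phi> * of_int s - of_int t"
  \<comment> \<open>The half-open interval ends at the strict upper bound; \<open>rw\<close> puts
    its left end above (c - 1) / r.\<close>
  obtain a :: nat and b :: int where a: "a < fib (n + 2)"
    and b: "(c + (\<phi> - 1)) / real r - w \<le> b - \<phi> * a" "b - \<phi> * a < (c + (\<phi> - 1)) / real r"
    using golden_ratio_multiples_gap[of n "(c + (\<phi> - 1)) / real r - w"]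
    unfolding \<phi>_def w_def by auto
  have "(c + (\<phi> - 1)) - real r * w \<le> real r * (b - \<phi> * a)" "real r * (b - \<phi> * a) < c + (\<phi> - 1)"
    using b \<open>r > 0\<close> by (simp_all add: field_simps)
  then have strip: "- 1 < of_int (t + r * b) - \<phi> * of_int (s + r * a)"
      "of_int (t + r * b) - \<phi> * of_int (s + r * a) < \<phi> - 1"
    using rw by (simp_all add: c_def algebra_simps)
  define u where "u = nat (s + r * a)"
  have u: "int u = s + r * a"
    using assms by (simp add: u_def)
  \<comment> \<open>\<open>b\<close> may be negative, but an integer above -1 is a natural
    number.\<close>
  have "0 \<le> \<phi> * real u"
    using phi by simp
  then have "(- 1 :: real) < of_int (t + r * b)"
    using strip(1) unfolding u[symmetric] by simp
  then have "0 \<le> t + r * b"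
    by linarith
  then obtain v where v: "int v = t + r * b"
    by (metis nonneg_int_cases)
  have uv: "- 1 < real v - \<phi> * real u" "real v - \<phi> * real u < \<phi> - 1"
    using strip unfolding u[symmetric] v[symmetric] by simp_all
  have cong: "[int u = s] (mod int r)" "[int v = t] (mod int r)"
    by (simp_all add: u v cong_def)
  have "u \<noteq> 0"
  proof
    assume "u = 0"
    then have "v = 0"
      using uv phi by simp
    then have "[s = 0] (mod int r)" "[t = 0] (mod int r)"
      using cong \<open>u = 0\<close> by (simp_all add: cong_sym)
    then show False
      using False assms by (simp add: cong_def)
  qed
  moreover have "v \<noteq> 0"
  proof
    assume "v = 0"
    moreover have "\<phi> * 1 \<le> \<phi> * real u"
      using phi \<open>u \<noteq> 0\<close> by (intro mult_left_mono) auto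
    ultimately show False
      using uv phi by simp
  qed
  moreover have "hofstadter_G v = u"
    using uv unfolding \<phi>_def by (rule hofstadter_G_eqI)
  \<comment> \<open>The chain is v + 1 < \<phi> (u + 1) \<le> \<phi> r F (h+1) < r F (h+2) + 1 \<le>
    F (2h+2); strictness between integers gives the final -2.\<close>
  moreover have "int v \<le> int (fib (2 * h + 2)) - 2"
  proof -
    have "int r * (int a + 1) \<le> int r * int (fib (Suc h))"
      using a by (intro mult_left_mono) (auto simp: h)
    then have "int u + 1 \<le> int (r * fib (Suc h))"
      using assms by (simp add: u algebra_simps)
    then have "real u + 1 \<le> real r * real (fib (Suc h))"
      by (metis of_int_1 of_int_add of_int_le_iff of_int_of_nat_eq of_nat_mult)
    then have "\<phi> * (real u + 1) \<le> \<phi> * (real r * real (fib (Suc h)))"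
      using phi by (intro mult_left_mono) auto
    moreover have "\<phi> * (real r * real (fib (Suc h)))
        = real r * real (fib (h + 2)) - real r * (1 - \<phi>) ^ Suc h"
      unfolding \<phi>_def fib_diff_golden_ratio[symmetric] by (simp add: algebra_simps)
    moreover have "- (real r * (1 - \<phi>) ^ Suc h) < 1"
    proof -
      have "\<bar>real r * (1 - \<phi>) ^ Suc h\<bar> = (real r * (\<phi> - 1) ^ h) * (\<phi> - 1)"
        using phi by (simp add: abs_mult power_abs)
      also have "\<dots> < 1 * 1"
        using rh phi by (intro mult_strict_mono) auto
      finally show ?thesis
        by linarith
    qed
    moreover have "real r * real (fib (h + 2)) \<le> real (fib (2 * h + 2)) - 1"
    proof -
      have "int (r * fib (h + 2)) \<le> int (fib (2 * h + 2)) - 1"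
        using mult_fib_le_of_less_golden_ratio_power[of h r] assms by (simp split: if_splits)
      then show ?thesis
        by (metis of_int_1 of_int_diff of_int_le_iff of_int_of_nat_eq of_nat_mult)
    qed
    ultimately have "real v + 1 < real (fib (2 * h + 2))"
      using uv by (simp add: distrib_left)
    then show ?thesis
      by linarith
  qed
  ultimately show ?thesis
    using cong unfolding hofstadter_G_pair_def by blast
qed

end
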